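(* For every $0\le r\le\pi$, one has $\Gamma_r+\Gamma_r\subseteq\Gamma_r$. Moreover, if $(k,\ell)\in\Gamma_r$, then $(k+d,\ell+d)\in\Gamma_r$ for every integer $d\ge0$, and every pair of integers $(k',\ell')$ satisfying $k'\ge k$, $\ell'\le\ell$, and $k'\le\ell'$ also belongs to $\Gamma_r$.
   Context: For $m\ge1$, $\mathbb S^m\subset\mathbb R^{m+1}$ is the unit round sphere with geodesic metric $\arccos\langle x,x'\rangle$; $\mathbb S^0$ is two points at distance $\pi$. The group $C_2$ of order two acts antipodally on each sphere; a map between $C_2$-spaces is odd if it is $C_2$-equivariant. The coindex of a $C_2$-space $X$ is $\mathrm{coind}(X):=\sup\{k\ge0:\text{there is a continuous odd map }\mathbb S^k\to X\}$. $\mathrm{VR}(X;r)$ is the geometric realization of the simplicial complex with vertex set $X$ whose simplices are the nonempty finite subsets of diameter at most $r$; $\mathrm{VR}(\mathbb S^m;r)$ carries the $C_2$-action induced by the antipodal map. For integers $0\le m\le n$, $c_{m,n}:=\inf\{r\ge0:\mathrm{coind}(\mathrm{VR}(\mathbb S^m;r))\ge n\}$. For $0\le r\le\pi$, $\Gamma_r:=\{(k,\ell)\in\mathbb N^2:1\le k\le\ell,\ c_{k-1,\ell-1}\le r\}$; addition of pairs is coordinatewise. *)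

theory Defs
  imports "HOL-Analysis.Analysis"
begin

text \<open>A complex is given by its set \<open>K\<close> of nonempty finite simplices.  A point of the
  realization is the family of its barycentric coordinates, extended by zero to the whole
  vertex type.\<close>

definition closed_simplex :: "'v set \<Rightarrow> ('v \<Rightarrow> real) set" where
  "closed_simplex \<sigma> = {t. (\<forall>v. 0 \<le> t v) \<and> (\<forall>v. v \<notin> \<sigma> \<longrightarrow> t v = 0) \<and> (\<Sum>v\<in>\<sigma>. t v) = 1}"

text \<open>Since \<open>\<sigma>\<close> is finite and the coordinates outside \<open>\<sigma>\<close> vanish, the topology of pointwise
  convergence is the Euclidean topology of the simplex.\<close>

definition closed_simplex_topology :: "'v set \<Rightarrow> ('v \<Rightarrow> real) topology" where
  "closed_simplex_topology \<sigma> = subtopology (powertop_real UNIV) (closed_simplex \<sigma>)"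

text \<open>The weak (coherent) topology: a set is open iff its trace on each closed simplex is open
  there.  For infinite complexes this is in general finer than the product topology.\<close>

definition geometric_realization :: "'v set set \<Rightarrow> ('v \<Rightarrow> real) topology" where
  "geometric_realization K =
     topology (\<lambda>U. U \<subseteq> (\<Union>\<sigma>\<in>K. closed_simplex \<sigma>) \<and>
                   (\<forall>\<sigma>\<in>K. openin (closed_simplex_topology \<sigma>) (U \<inter> closed_simplex \<sigma>)))"

lemma topspace_closed_simplex_topology [simp]:
  "topspace (closed_simplex_topology \<sigma>) = closed_simplex \<sigma>"
  by (simp add: closed_simplex_topology_def)

lemma openin_geometric_realization:
  "openin (geometric_realization K) U \<longleftrightarrow>
     U \<subseteq> (\<Union>\<sigma>\<in>K. closed_simplex \<sigma>) \<and>
     (\<forall>\<sigma>\<in>K. openin (closed_simplex_topology \<sigma>) (U \<inter> closed_simplex \<sigma>))"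
proof -
  have int: "openin (closed_simplex_topology \<sigma>) (A \<inter> B \<inter> closed_simplex \<sigma>)"
    if "openin (closed_simplex_topology \<sigma>) (A \<inter> closed_simplex \<sigma>)"
       "openin (closed_simplex_topology \<sigma>) (B \<inter> closed_simplex \<sigma>)" for A B \<sigma>
    using openin_Int[OF that] by (simp add: Int_ac)
  have un: "openin (closed_simplex_topology \<sigma>) (\<Union>\<U> \<inter> closed_simplex \<sigma>)"
    if "\<forall>U\<in>\<U>. openin (closed_simplex_topology \<sigma>) (U \<inter> closed_simplex \<sigma>)" for \<U> \<sigma>
    unfolding Int_Union2 using that by (intro openin_Union) auto
  have "istopology (\<lambda>U. U \<subseteq> (\<Union>\<sigma>\<in>K. closed_simplex \<sigma>) \<and>
          (\<forall>\<sigma>\<in>K. openin (closed_simplex_topology \<sigma>) (U \<inter> closed_simplex \<sigma>)))"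
    unfolding istopology_def by (intro conjI allI impI ballI int un Sup_least) blast+
  then show ?thesis
    by (simp add: geometric_realization_def topology_inverse')
qed

lemma topspace_geometric_realization [simp]:
  "topspace (geometric_realization K) = (\<Union>\<sigma>\<in>K. closed_simplex \<sigma>)"
proof
  show "topspace (geometric_realization K) \<subseteq> (\<Union>\<sigma>\<in>K. closed_simplex \<sigma>)"
    using openin_geometric_realization openin_topspace by blast
  have "(\<Union>\<tau>\<in>K. closed_simplex \<tau>) \<inter> closed_simplex \<sigma> = topspace (closed_simplex_topology \<sigma>)"
    if "\<sigma> \<in> K" for \<sigma>
    using that by auto
  then have "openin (geometric_realization K) (\<Union>\<sigma>\<in>K. closed_simplex \<sigma>)"
    unfolding openin_geometric_realization by (metis openin_topspace order_refl)
  then show "(\<Union>\<sigma>\<in>K. closed_simplex \<sigma>) \<subseteq> topspace (geometric_realization K)"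
    by (rule openin_subset)
qed

text \<open>The map of realizations induced by a map \<open>f\<close> of vertices: affine on each simplex,
  sending the vertex \<open>v\<close> to \<open>f v\<close>.\<close>

definition realization_map :: "('v \<Rightarrow> 'w) \<Rightarrow> ('v \<Rightarrow> real) \<Rightarrow> 'w \<Rightarrow> real" where
  "realization_map f t = (\<lambda>w. \<Sum>v | t v \<noteq> 0 \<and> f v = w. t v)"

text \<open>The library's \<open>nsphere m\<close> is the unit sphere in the space of real sequences vanishing
  from index \<open>m + 1\<close> on.\<close>

definition antipode :: "(nat \<Rightarrow> real) \<Rightarrow> nat \<Rightarrow> real" where
  "antipode x = (\<lambda>i. - x i)"

definition sphere_dist :: "nat \<Rightarrow> (nat \<Rightarrow> real) \<Rightarrow> (nat \<Rightarrow> real) \<Rightarrow> real" where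
  "sphere_dist m x y = arccos (\<Sum>i\<le>m. x i * y i)"

definition VR_complex :: "'v set \<Rightarrow> ('v \<Rightarrow> 'v \<Rightarrow> real) \<Rightarrow> real \<Rightarrow> 'v set set" where
  "VR_complex X d r =
     {\<sigma>. \<sigma> \<noteq> {} \<and> finite \<sigma> \<and> \<sigma> \<subseteq> X \<and> (SUP (x, y)\<in>\<sigma> \<times> \<sigma>. d x y) \<le> r}"

definition VR_sphere :: "nat \<Rightarrow> real \<Rightarrow> ((nat \<Rightarrow> real) \<Rightarrow> real) topology" where
  "VR_sphere m r =
     geometric_realization (VR_complex (topspace (nsphere m)) (sphere_dist m) r)"

text \<open>A space with an action of the group of order two is given by its topology \<open>X\<close> and the
  action \<open>a\<close> of the generator.  The supremum is taken in \<open>enat\<close>, so it is \<open>\<infinity>\<close> when the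
  dimensions are unbounded; the value \<open>0\<close> at the empty space is never used, since
  \<open>VR_sphere m r\<close> is nonempty for \<open>r \<ge> 0\<close>.\<close>

definition odd_map :: "nat \<Rightarrow> 'a topology \<Rightarrow> ('a \<Rightarrow> 'a) \<Rightarrow> ((nat \<Rightarrow> real) \<Rightarrow> 'a) \<Rightarrow> bool" where
  "odd_map k X a f \<longleftrightarrow> (\<forall>x\<in>topspace (nsphere k). f (antipode x) = a (f x))"

definition coind :: "'a topology \<Rightarrow> ('a \<Rightarrow> 'a) \<Rightarrow> enat" where
  "coind X a = Sup {enat k |k. \<exists>f. continuous_map (nsphere k) X f \<and> odd_map k X a f}"

text \<open>Only used for \<open>m \<le> n\<close>.  The set is nonempty, as at \<open>r = pi\<close> the action on
  \<open>VR_sphere m r\<close> fixes the midpoint of any two antipodal vertices.\<close>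

definition c_VR :: "nat \<Rightarrow> nat \<Rightarrow> real" where
  "c_VR m n = Inf {r. 0 \<le> r \<and> enat n \<le> coind (VR_sphere m r) (realization_map antipode)}"

definition Gam :: "real \<Rightarrow> (nat \<times> nat) set" where
  "Gam r = {(k, l). 1 \<le> k \<and> k \<le> l \<and> c_VR (k - 1) (l - 1) \<le> r}"

lemma antipode_antipode [simp]: "antipode (antipode x) = x"
  by (simp add: antipode_def)

lemma antipode_eq_iff: "antipode x = y \<longleftrightarrow> x = antipode y"
  by auto

lemma realization_map_antipode: "realization_map antipode t = t \<circ> antipode"
proof
  fix w
  have "{v. t v \<noteq> 0 \<and> antipode v = w} = (if t (antipode w) = 0 then {} else {antipode w})"
    by (auto simp: antipode_eq_iff)
  then show "realization_map antipode t w = (t \<circ> antipode) w"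
    by (simp add: realization_map_def)
qed

lemma realization_map_antipode_involution:
  "realization_map antipode (realization_map antipode t) = t"
  by (simp add: realization_map_antipode fun_eq_iff)

lemma antipode_in_nsphere: "x \<in> topspace (nsphere m) \<Longrightarrow> antipode x \<in> topspace (nsphere m)"
  by (simp add: nsphere antipode_def)

lemma sphere_dist_antipode: "sphere_dist m (antipode x) (antipode y) = sphere_dist m x y"
  by (simp add: sphere_dist_def antipode_def)

lemma antipode_image_VR_complex:
  assumes "\<sigma> \<in> VR_complex (topspace (nsphere m)) (sphere_dist m) r"
  shows "antipode ` \<sigma> \<in> VR_complex (topspace (nsphere m)) (sphere_dist m) r"
proof -
  have "antipode ` \<sigma> \<times> antipode ` \<sigma> = map_prod antipode antipode ` (\<sigma> \<times> \<sigma>)"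
    by force
  then have "(SUP (x, y)\<in>antipode ` \<sigma> \<times> antipode ` \<sigma>. sphere_dist m x y)
      = (SUP (x, y)\<in>\<sigma> \<times> \<sigma>. sphere_dist m x y)"
    by (simp add: image_image case_prod_unfold sphere_dist_antipode)
  with assms show ?thesis
    by (auto simp: VR_complex_def antipode_in_nsphere)
qed

lemma realization_map_antipode_closed_simplex:
  "realization_map antipode t \<in> closed_simplex (antipode ` \<sigma>) \<longleftrightarrow> t \<in> closed_simplex \<sigma>"
proof -
  have inj: "inj_on antipode \<sigma>"
    by (rule inj_on_inverseI[where g = antipode]) simp
  have "v \<in> antipode ` \<sigma> \<longleftrightarrow> antipode v \<in> \<sigma>" for v
    by (metis antipode_antipode imageE imageI)
  then show ?thesis
    by (simp add: closed_simplex_def realization_map_antipode sum.reindex[OF inj] o_def)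
       (metis antipode_antipode)
qed

lemma continuous_map_realization_map_antipode:
  "continuous_map (VR_sphere m r) (VR_sphere m r) (realization_map antipode)"
proof -
  let ?K = "VR_complex (topspace (nsphere m)) (sphere_dist m) r"
  let ?a = "realization_map antipode"
  let ?X = "VR_sphere m r"
  have img: "?a t \<in> topspace ?X" if "t \<in> topspace ?X" for t
    using that antipode_image_VR_complex[of _ m r]
    by (auto simp: VR_sphere_def)
       (metis realization_map_antipode_closed_simplex)
  have "openin ?X {t \<in> topspace ?X. ?a t \<in> U}" if U: "openin ?X U" for U
  proof -
    have "openin (closed_simplex_topology \<sigma>)
            ({t \<in> topspace ?X. ?a t \<in> U} \<inter> closed_simplex \<sigma>)" if \<sigma>: "\<sigma> \<in> ?K" for \<sigma>
    proof -
      have cont: "continuous_map (closed_simplex_topology \<sigma>)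
                    (closed_simplex_topology (antipode ` \<sigma>)) ?a"
        unfolding closed_simplex_topology_def
      proof (rule continuous_map_into_subtopology)
        show "continuous_map (subtopology (powertop_real UNIV) (closed_simplex \<sigma>))
                (powertop_real UNIV) ?a"
          by (auto simp: continuous_map_componentwise_UNIV realization_map_antipode
              intro!: continuous_map_from_subtopology continuous_map_product_projection)
      qed (auto simp: realization_map_antipode_closed_simplex)
      have "openin (closed_simplex_topology (antipode ` \<sigma>)) (U \<inter> closed_simplex (antipode ` \<sigma>))"
        using U antipode_image_VR_complex[OF \<sigma>]
        by (simp add: VR_sphere_def openin_geometric_realization)
      from openin_continuous_map_preimage[OF cont this]
      have "openin (closed_simplex_topology \<sigma>)
              {t \<in> closed_simplex \<sigma>. ?a t \<in> U \<inter> closed_simplex (antipode ` \<sigma>)}"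
        by simp
      moreover have "{t \<in> closed_simplex \<sigma>. ?a t \<in> U \<inter> closed_simplex (antipode ` \<sigma>)}
          = {t \<in> topspace ?X. ?a t \<in> U} \<inter> closed_simplex \<sigma>"
        using \<sigma> by (auto simp: VR_sphere_def realization_map_antipode_closed_simplex)
      ultimately show ?thesis by simp
    qed
    then show ?thesis
      by (auto simp: VR_sphere_def openin_geometric_realization)
  qed
  with img show ?thesis
    by (auto simp: continuous_map_def)
qed

end

theory Submission
  imports Defs
begin

text \<open>A pair \<open>(m + 1, n + 1)\<close> with \<open>m \<le> n\<close> belongs to \<open>Gam r\<close> iff for every \<open>r' > r\<close> there is
  an odd map from the \<open>n\<close>-sphere to the Vietoris--Rips complex of the \<open>m\<close>-sphere at scale
  \<open>r'\<close> (\<open>Gam_Suc_iff\<close>).  Monotonicity is then immediate: restrict an odd map to an equatorial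
  sphere, and enlarge the complex along the isometric inclusion of a sphere as an equator.

  Closure under addition comes from joins.  Place two spheres in orthogonal subspaces, so that
  the unit sphere of the sum is their join.  Points of different factors are then at distance
  \<open>pi/2\<close>, so for \<open>r' \<ge> pi/2\<close> the union of a simplex from each complex is again a simplex, and
  the join of two odd maps \<open>f\<close> and \<open>g\<close> is an odd map into the complex of the larger sphere:
  it sends \<open>(x, y)\<close> to \<open>f (x / |x|)\<close> and \<open>g (y / |y|)\<close> mixed with weights \<open>|x|^2\<close> and
  \<open>|y|^2\<close> (\<open>finitely_carried_odd_join\<close>).

  When \<open>r < pi/2\<close> the join is formed at scale \<open>pi/2\<close>, and that scale is as good as any
  smaller positive one.  The vertices of a simplex of diameter at most \<open>pi/2\<close> have pairwise
  nonnegative inner products, so their barycentric combinations are nonzero, and normalizing them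
  turns an odd map into the complex into an odd map of spheres
  (\<open>finitely_carried_odd_halfpi_imp_odd_sphere_map\<close>).  Conversely, a partition of unity
  subordinate to small balls around an antipodally symmetric finite set turns an odd map of
  spheres into an odd map into the complex at any positive scale
  (\<open>odd_sphere_map_imp_finitely_carried\<close>).  Applied to the identity map, the
  latter also shows \<open>(1, 1) \<in> Gam r\<close>, whence closure under addition of \<open>(d, d)\<close>.

  Continuity for the weak topology is reduced to coordinates: a compact set meets only finitely
  many open simplices, so a map from a compact space into a realization is continuous iff its
  image lies in finitely many simplices and its barycentric coordinates are continuous
  (\<open>continuous_map_geometric_realization_iff\<close>).\<close>

section \<open>Maps of compact spaces into realizations\<close>

lemma closed_closed_simplex: "closed (closed_simplex \<sigma> :: ('v \<Rightarrow> real) set)"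
proof -
  have coord: "continuous_on UNIV (\<lambda>t::'v \<Rightarrow> real. t v)" for v
    by simp
  have "closed {t::'v \<Rightarrow> real. (\<forall>v. 0 \<le> t v) \<and> (\<forall>v. v \<notin> \<sigma> \<longrightarrow> t v = 0) \<and> (\<Sum>v\<in>\<sigma>. t v) = 1}"
    by (intro closed_Collect_conj closed_Collect_all closed_Collect_le closed_Collect_imp
        closed_Collect_eq open_Collect_const continuous_on_sum coord continuous_on_const)
  then show ?thesis
    by (simp add: closed_simplex_def)
qed

lemma closedin_geometric_realization:
  "closedin (geometric_realization K) C \<longleftrightarrow>
     C \<subseteq> (\<Union>\<sigma>\<in>K. closed_simplex \<sigma>) \<and> (\<forall>\<sigma>\<in>K. closed (C \<inter> closed_simplex \<sigma>))"
proof -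
  have "openin (closed_simplex_topology \<sigma>) (((\<Union>\<tau>\<in>K. closed_simplex \<tau>) - C) \<inter> closed_simplex \<sigma>)
      \<longleftrightarrow> closed (C \<inter> closed_simplex \<sigma>)" if "\<sigma> \<in> K" for \<sigma>
  proof -
    have "((\<Union>\<tau>\<in>K. closed_simplex \<tau>) - C) \<inter> closed_simplex \<sigma>
        = closed_simplex \<sigma> - C \<inter> closed_simplex \<sigma>"
      using that by auto
    moreover have "openin (closed_simplex_topology \<sigma>) (closed_simplex \<sigma> - C \<inter> closed_simplex \<sigma>)
        \<longleftrightarrow> closedin (closed_simplex_topology \<sigma>) (C \<inter> closed_simplex \<sigma>)"
      by (simp add: closedin_def)
    moreover have "\<dots> \<longleftrightarrow> closed (C \<inter> closed_simplex \<sigma>)"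
      unfolding closed_simplex_topology_def euclidean_product_topology
      by (metis closed_closed_simplex closedin_closed_eq inf_le2)
    ultimately show ?thesis
      by simp
  qed
  then show ?thesis
    by (auto simp: closedin_def openin_geometric_realization)
qed

lemma continuous_map_realization_coordinate:
  "continuous_map (geometric_realization K) euclideanreal (\<lambda>t. t v)"
proof -
  have "closed ({t \<in> (\<Union>\<sigma>\<in>K. closed_simplex \<sigma>). t v \<in> C} \<inter> closed_simplex \<sigma>)"
    if "closed C" "\<sigma> \<in> K" for C :: "real set" and \<sigma>
  proof -
    have "closed ((\<lambda>t. t v) -` C)"
      using that by (intro closed_vimage) simp_all
    moreover have "{t \<in> (\<Union>\<sigma>\<in>K. closed_simplex \<sigma>). t v \<in> C} \<inter> closed_simplex \<sigma>
        = (\<lambda>t. t v) -` C \<inter> closed_simplex \<sigma>"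
      using that by auto
    ultimately show ?thesis
      using closed_Int[OF _ closed_closed_simplex] by simp
  qed
  then show ?thesis
    by (auto simp: continuous_map_closedin closedin_geometric_realization)
qed

text \<open>Points with distinct supports lie in distinct open simplices.  A set of such points has at
  most as many points in a given simplex as that simplex has faces, so all its subsets are closed;
  hence it is closed and discrete, and finite if it lies in a compact set.\<close>

lemma compact_meets_finitely_many_open_simplices:
  assumes fin: "\<And>\<sigma>. \<sigma> \<in> K \<Longrightarrow> finite \<sigma>"
    and A: "compactin (geometric_realization K) A"
  shows "finite ((\<lambda>t. {v. t v \<noteq> 0}) ` A)"
proof (rule ccontr)
  let ?supp = "\<lambda>t::'a \<Rightarrow> real. {v. t v \<noteq> 0}"
  assume inf: "infinite (?supp ` A)"
  \<comment> \<open>One point of \<open>A\<close> for each open simplex that \<open>A\<close> meets.\<close>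
  obtain P where P: "P \<subseteq> A" "inj_on ?supp P" "?supp ` A = ?supp ` P"
    using subset_image_inj[of "?supp ` A" ?supp A] by auto
  have closed: "closedin (geometric_realization K) Q" if "Q \<subseteq> P" for Q
  proof -
    have "closed (Q \<inter> closed_simplex \<sigma>)" if \<sigma>: "\<sigma> \<in> K" for \<sigma>
    proof -
      have "?supp ` (Q \<inter> closed_simplex \<sigma>) \<subseteq> Pow \<sigma>"
        by (auto simp: closed_simplex_def)
      moreover have "inj_on ?supp (Q \<inter> closed_simplex \<sigma>)"
        using P(2) \<open>Q \<subseteq> P\<close> by (meson inf_le1 inj_on_subset subset_trans)
      ultimately have "finite (Q \<inter> closed_simplex \<sigma>)"
        using fin[OF \<sigma>] by (meson finite_Pow_iff finite_subset inj_on_finite)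
      moreover have "closed {t}" for t :: "'a \<Rightarrow> real"
      proof -
        have "closed {s. \<forall>v. s v = t v}"
          by (intro closed_Collect_all closed_Collect_eq) simp_all
        then show ?thesis
          by (simp flip: fun_eq_iff)
      qed
      ultimately have "closed (\<Union>t\<in>Q \<inter> closed_simplex \<sigma>. {t})"
        by (intro closed_UN) auto
      then show ?thesis
        by simp
    qed
    moreover have "Q \<subseteq> topspace (geometric_realization K)"
      using that P(1) compactin_subset_topspace[OF A] by blast
    ultimately show ?thesis
      by (simp add: closedin_geometric_realization)
  qed
  have "infinite P"
    using inf P(3) by auto
  then obtain p where p: "p \<in> (geometric_realization K) derived_set_of P"
    using compactin_imp_Bolzano_Weierstrass[OF A] P(1) by blast
  let ?U = "topspace (geometric_realization K) - (P - {p})"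
  have "openin (geometric_realization K) ?U"
    using closed[of "P - {p}"] by blast
  moreover have "p \<in> ?U"
    using p by (auto simp: in_derived_set_of)
  ultimately obtain y where "y \<noteq> p" "y \<in> P" "y \<in> ?U"
    using p unfolding in_derived_set_of by meson
  then show False
    by blast
qed

text \<open>A finite union of closed simplices carries the topology of pointwise convergence,
  although the whole realization has a finer topology in general; by the preceding lemma a
  compact image lies in such a union.\<close>

lemma continuous_map_geometric_realization_iff:
  assumes fin: "\<And>\<sigma>. \<sigma> \<in> K \<Longrightarrow> finite \<sigma>" and X: "compact_space X"
  shows "continuous_map X (geometric_realization K) f \<longleftrightarrow>
    (\<forall>v. continuous_map X euclideanreal (\<lambda>x. f x v)) \<and>
    (\<exists>F. finite F \<and> F \<subseteq> K \<and> (\<forall>x\<in>topspace X. \<exists>\<sigma>\<in>F. f x \<in> closed_simplex \<sigma>))"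
proof (intro iffI conjI allI; (elim conjE exE)?)
  assume f: "continuous_map X (geometric_realization K) f"
  show "continuous_map X euclideanreal (\<lambda>x. f x v)" for v
    using continuous_map_compose[OF f continuous_map_realization_coordinate] by (simp add: o_def)
  let ?supp = "\<lambda>t::'a \<Rightarrow> real. {v. t v \<noteq> 0}"
  let ?A = "f ` topspace X"
  have A: "compactin (geometric_realization K) ?A"
    using X f image_compactin compact_space_def by blast
  have "\<forall>t\<in>?A. \<exists>\<sigma>\<in>K. t \<in> closed_simplex \<sigma>"
    using compactin_subset_topspace[OF A] by auto
  then obtain s where s: "\<And>t. t \<in> ?A \<Longrightarrow> s t \<in> K \<and> t \<in> closed_simplex (s t)"
    by metis
  \<comment> \<open>One point for each occurring support; the simplices of \<open>K\<close> chosen for these points contain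
    every point of the image, since membership depends on the support only.\<close>
  obtain P where P: "P \<subseteq> ?A" "inj_on ?supp P" "?supp ` ?A = ?supp ` P"
    using subset_image_inj[of "?supp ` ?A" ?supp ?A] by auto
  have "finite P"
    using compact_meets_finitely_many_open_simplices[OF fin A] P
    by (metis finite_imageD)
  moreover have "s ` P \<subseteq> K"
    using s P by auto
  moreover have "\<exists>\<sigma>\<in>s ` P. f x \<in> closed_simplex \<sigma>" if x: "x \<in> topspace X" for x
  proof -
    obtain p where p: "p \<in> P" "?supp (f x) = ?supp p"
    proof -
      have "?supp (f x) \<in> ?supp ` P"
        using x by (subst P(3)[symmetric]) blast
      then show thesis
        by (auto intro: that)
    qed
    have 1: "p \<in> closed_simplex (s p)" "finite (s p)"
      using s[of p] P(1) p(1) fin by auto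
    have 2: "f x \<in> closed_simplex (s (f x))" "finite (s (f x))"
      using s[of "f x"] x fin by auto
    have sub: "?supp (f x) \<subseteq> s p" "?supp (f x) \<subseteq> s (f x)"
      using 1 2 p(2) unfolding closed_simplex_def by blast+
    have "sum (f x) (s p) = sum (f x) (?supp (f x))"
      using sub(1) 1(2) by (intro sum.mono_neutral_right) auto
    also have "\<dots> = sum (f x) (s (f x))"
      using sub(2) 2(2) by (intro sum.mono_neutral_left) auto
    finally have "f x \<in> closed_simplex (s p)"
      using 2 sub(1) unfolding closed_simplex_def by auto
    then show ?thesis
      using p(1) by blast
  qed
  ultimately show "\<exists>F. finite F \<and> F \<subseteq> K \<and> (\<forall>x\<in>topspace X. \<exists>\<sigma>\<in>F. f x \<in> closed_simplex \<sigma>)"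
    by (intro exI[of _ "s ` P"]) auto
next
  fix F
  assume coord: "\<forall>v. continuous_map X euclideanreal (\<lambda>x. f x v)"
    and F: "finite F" "F \<subseteq> K" "\<forall>x\<in>topspace X. \<exists>\<sigma>\<in>F. f x \<in> closed_simplex \<sigma>"
  have f: "continuous_map X euclidean f"
    using coord unfolding euclidean_product_topology[symmetric]
    by (simp add: continuous_map_componentwise_UNIV)
  have "closedin X {x \<in> topspace X. f x \<in> C}" if C: "closedin (geometric_realization K) C" for C
  proof -
    have "{x \<in> topspace X. f x \<in> C}
        = (\<Union>\<sigma>\<in>F. {x \<in> topspace X. f x \<in> C \<inter> closed_simplex \<sigma>})"
      using F by auto
    moreover have "closedin X {x \<in> topspace X. f x \<in> C \<inter> closed_simplex \<sigma>}" if "\<sigma> \<in> F" for \<sigma>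
      using C F that
      by (intro closedin_continuous_map_preimage[OF f]) (auto simp: closedin_geometric_realization)
    ultimately show ?thesis
      using closedin_Union[of "(\<lambda>\<sigma>. {x \<in> topspace X. f x \<in> C \<inter> closed_simplex \<sigma>}) ` F" X] F(1)
      by auto
  qed
  moreover have "f x \<in> topspace (geometric_realization K)" if "x \<in> topspace X" for x
    using F that by (auto simp: subset_iff) blast
  ultimately show "continuous_map X (geometric_realization K) f"
    by (auto simp: continuous_map_closedin)
qed

section \<open>Spheres and their Vietoris--Rips complexes\<close>

abbreviation Sph :: "nat \<Rightarrow> (nat \<Rightarrow> real) set" where
  "Sph n \<equiv> topspace (nsphere n)"

lemma Sph_iff: "x \<in> Sph n \<longleftrightarrow> (\<Sum>i\<le>n. (x i)\<^sup>2) = 1 \<and> (\<forall>i>n. x i = 0)"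
  by (simp add: nsphere)

lemma nsphere_eq_top_of_set: "nsphere n = top_of_set (Sph n)"
  by (simp add: nsphere euclidean_product_topology)

lemma continuous_map_nsphere_iff:
  "continuous_map (nsphere n) euclidean f \<longleftrightarrow> continuous_on (Sph n) f"
  by (subst nsphere_eq_top_of_set) simp

text \<open>The sphere is a closed subset of a product of intervals, compact by Tychonoff's theorem.\<close>

lemma compact_Sph: "compact (Sph n)"
proof -
  have "compactin (powertop_real UNIV) (PiE UNIV (\<lambda>_. {-1..1}))"
    unfolding compactin_PiE by (intro disjI2 ballI) (simp only: compactin_euclidean_iff compact_Icc)
  then have "compact {x::nat \<Rightarrow> real. \<forall>i. x i \<in> {-1..1}}"
    by (simp add: euclidean_product_topology PiE_UNIV_domain Pi_def)
  moreover have "closed {x::nat \<Rightarrow> real. (\<Sum>i\<le>n. (x i)\<^sup>2) = 1 \<and> (\<forall>i>n. x i = 0)}"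
    by (intro closed_Collect_conj closed_Collect_all closed_Collect_imp closed_Collect_eq
        open_Collect_const continuous_on_sum continuous_on_power continuous_on_const
        continuous_on_product_coordinates)
  ultimately have "compact ({x. (\<Sum>i\<le>n. (x i)\<^sup>2) = 1 \<and> (\<forall>i>n. x i = 0)}
      \<inter> {x::nat \<Rightarrow> real. \<forall>i. x i \<in> {-1..1}})"
    by (intro closed_Int_compact)
  moreover have "x i \<in> {-1..1}" if "(\<Sum>i\<le>n. (x i)\<^sup>2) = 1" "\<forall>i>n. x i = 0" for x :: "nat \<Rightarrow> real" and i
  proof (cases "i \<le> n")
    case True
    then have "(x i)\<^sup>2 \<le> (\<Sum>i\<le>n. (x i)\<^sup>2)"
      by (intro member_le_sum) auto
    then show ?thesis
      using that by (simp add: abs_square_le_1 abs_le_iff)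
  qed (use that in auto)
  then have "Sph n = {x. (\<Sum>i\<le>n. (x i)\<^sup>2) = 1 \<and> (\<forall>i>n. x i = 0)}
      \<inter> {x::nat \<Rightarrow> real. \<forall>i. x i \<in> {-1..1}}"
    by (auto simp: nsphere)
  ultimately show ?thesis
    by simp
qed

lemma Sph_mono: "m \<le> n \<Longrightarrow> Sph m \<subseteq> Sph n"
proof
  fix x assume "m \<le> n" "x \<in> Sph m"
  moreover from this have "(\<Sum>i\<le>n. (x i)\<^sup>2) = (\<Sum>i\<le>m. (x i)\<^sup>2)"
    by (intro sum.mono_neutral_right) (auto simp: Sph_iff)
  ultimately show "x \<in> Sph n"
    by (auto simp: Sph_iff)
qed

lemma abs_inner_Sph_le_1:
  assumes "v \<in> Sph m" "w \<in> Sph m"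
  shows "\<bar>\<Sum>i\<le>m. v i * w i\<bar> \<le> 1"
  using Cauchy_Schwarz_ineq_sum[of v w "{..m}"] assms
  by (simp add: Sph_iff abs_square_le_1)

lemma sphere_dist_le_iff:
  assumes "v \<in> Sph m" "w \<in> Sph m" "0 \<le> r" "r \<le> pi"
  shows "sphere_dist m v w \<le> r \<longleftrightarrow> cos r \<le> (\<Sum>i\<le>m. v i * w i)"
proof -
  have "\<bar>\<Sum>i\<le>m. v i * w i\<bar> \<le> 1"
    using assms abs_inner_Sph_le_1 by blast
  then show ?thesis
    unfolding sphere_dist_def
    using cos_mono_le_eq[of r "arccos (\<Sum>i\<le>m. v i * w i)"] assms
    by (simp add: abs_le_iff arccos_lbound arccos_ubound minus_le_iff)
qed

lemma sphere_dist_le_pi: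
  assumes "v \<in> Sph m" "w \<in> Sph m"
  shows "sphere_dist m v w \<le> pi"
  using abs_inner_Sph_le_1[OF assms]
  unfolding sphere_dist_def by (intro arccos_ubound) auto

text \<open>The additional coordinates of \<open>v\<close> vanish, so the inclusion as an equator is isometric.\<close>

lemma sphere_dist_mono_dim:
  assumes "m \<le> m'" "v \<in> Sph m"
  shows "sphere_dist m' v w = sphere_dist m v w"
proof -
  have "(\<Sum>i\<le>m'. v i * w i) = (\<Sum>i\<le>m. v i * w i)"
    using assms by (intro sum.mono_neutral_right) (auto simp: Sph_iff)
  then show ?thesis
    by (simp add: sphere_dist_def)
qed

lemma VR_complex_iff:
  "\<sigma> \<in> VR_complex X d r \<longleftrightarrow>
     \<sigma> \<noteq> {} \<and> finite \<sigma> \<and> \<sigma> \<subseteq> X \<and> (\<forall>v\<in>\<sigma>. \<forall>w\<in>\<sigma>. d v w \<le> r)"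
proof -
  have "(SUP (x, y)\<in>\<sigma> \<times> \<sigma>. d x y) \<le> r \<longleftrightarrow> (\<forall>v\<in>\<sigma>. \<forall>w\<in>\<sigma>. d v w \<le> r)"
    if "\<sigma> \<noteq> {}" "finite \<sigma>"
    using that by (subst cSup_le_iff) (auto intro!: bdd_above_finite)
  then show ?thesis
    unfolding VR_complex_def by blast
qed

abbreviation VRS :: "nat \<Rightarrow> real \<Rightarrow> (nat \<Rightarrow> real) set set" where
  "VRS m r \<equiv> VR_complex (Sph m) (sphere_dist m) r"

lemma VRS_mono:
  assumes "m \<le> m'" "r \<le> r'"
  shows "VRS m r \<subseteq> VRS m' r'"
proof
  fix \<sigma> assume \<sigma>: "\<sigma> \<in> VRS m r"
  have "sphere_dist m' v w \<le> r'" if "v \<in> \<sigma>" "w \<in> \<sigma>" for v w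
    using \<sigma> that sphere_dist_mono_dim[OF assms(1), of v w] assms(2)
    unfolding VR_complex_iff by fastforce
  then show "\<sigma> \<in> VRS m' r'"
    using \<sigma> Sph_mono[OF assms(1)] unfolding VR_complex_iff by blast
qed


lemma antipode_Sph_iff [simp]: "antipode x \<in> Sph n \<longleftrightarrow> x \<in> Sph n"
  by (simp add: Sph_iff antipode_def)

lemma antipode_mem_symmetrize_iff:
  "antipode v \<in> A \<union> antipode ` A \<longleftrightarrow> v \<in> A \<union> antipode ` A"
proof -
  have "w \<in> antipode ` A \<longleftrightarrow> antipode w \<in> A" for w
    by (metis antipode_antipode imageE imageI)
  then show ?thesis
    by auto
qed

section \<open>Odd maps into Vietoris--Rips complexes of spheres\<close>

text \<open>The conditions on the map that no longer refer to the weak topology, and hence can be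
  checked coordinate by coordinate.  The values of \<open>f\<close> off the sphere are arbitrary.\<close>

definition finitely_carried_odd ::
    "nat \<Rightarrow> nat \<Rightarrow> real \<Rightarrow> ((nat \<Rightarrow> real) \<Rightarrow> (nat \<Rightarrow> real) \<Rightarrow> real) \<Rightarrow> bool" where
  "finitely_carried_odd n m r f \<longleftrightarrow>
     (\<forall>x\<in>Sph n. \<forall>v. f (antipode x) v = f x (antipode v)) \<and>
     (\<forall>v. continuous_on (Sph n) (\<lambda>x. f x v)) \<and>
     (\<exists>F. finite F \<and> F \<subseteq> VRS m r \<and> (\<forall>x\<in>Sph n. \<exists>\<sigma>\<in>F. f x \<in> closed_simplex \<sigma>))"

lemma odd_map_into_VR_sphere_iff:
  "continuous_map (nsphere n) (VR_sphere m r) f \<and>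
     odd_map n (VR_sphere m r) (realization_map antipode) f \<longleftrightarrow> finitely_carried_odd n m r f"
proof -
  have "compact_space (nsphere n)"
    using compact_Sph[of n] nsphere_eq_top_of_set[of n]
    by (metis compact_space_subtopology compactin_euclidean_iff)
  then have "continuous_map (nsphere n) (VR_sphere m r) f \<longleftrightarrow>
      (\<forall>v. continuous_on (Sph n) (\<lambda>x. f x v)) \<and>
      (\<exists>F. finite F \<and> F \<subseteq> VRS m r \<and> (\<forall>x\<in>Sph n. \<exists>\<sigma>\<in>F. f x \<in> closed_simplex \<sigma>))"
    unfolding VR_sphere_def continuous_map_nsphere_iff[symmetric]
    by (intro continuous_map_geometric_realization_iff) (simp_all add: VR_complex_iff)
  then show ?thesis
    by (auto simp: odd_map_def finitely_carried_odd_def realization_map_antipode fun_eq_iff)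
qed

lemma finitely_carried_odd_mono:
  assumes "finitely_carried_odd n m r f" "n' \<le> n" "m \<le> m'" "r \<le> r'"
  shows "finitely_carried_odd n' m' r' f"
proof -
  have "Sph n' \<subseteq> Sph n" "VRS m r \<subseteq> VRS m' r'"
    using Sph_mono VRS_mono assms by auto
  then show ?thesis
    using assms(1) continuous_on_subset unfolding finitely_carried_odd_def
    by (metis (no_types, lifting) subset_iff)
qed

text \<open>At scale \<open>pi\<close> the midpoint of two antipodal vertices is a fixed point of the action, so a
  constant map is odd in every dimension.  In particular the infimum defining \<open>c_VR\<close> is taken over
  a nonempty set.\<close>

lemma finitely_carried_odd_pi: "\<exists>f. finitely_carried_odd n m pi f"
proof -
  define p :: "nat \<Rightarrow> real" where "p = (\<lambda>i. if i = 0 then 1 else 0)"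
  define t :: "(nat \<Rightarrow> real) \<Rightarrow> real" where "t = (\<lambda>v. if v \<in> {p, antipode p} then 1/2 else 0)"
  have p: "p \<in> Sph m"
    unfolding p_def by (rule in_topspace_nsphere)
  have ne: "p \<noteq> antipode p"
    by (auto simp: p_def antipode_def fun_eq_iff)
  have "t \<in> closed_simplex {p, antipode p}"
    using ne by (auto simp: closed_simplex_def t_def)
  moreover have "{p, antipode p} \<in> VRS m pi"
    using p sphere_dist_le_pi by (auto simp: VR_complex_iff)
  moreover have "t (antipode v) = t v" for v
    by (auto simp: t_def antipode_eq_iff)
  ultimately have "finitely_carried_odd n m pi (\<lambda>_. t)"
    unfolding finitely_carried_odd_def by (auto intro!: exI[of _ "{{p, antipode p}}"])
  then show ?thesis
    by blast
qed

section \<open>Passing between odd maps of spheres and odd maps into complexes\<close>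

text \<open>Compose the odd map \<open>q\<close> with the map of the sphere into the complex given by a partition of
  unity.  The finite set \<open>N\<close> of centres is closed under \<open>antipode\<close>, which makes the partition of
  unity equivariant; the bump functions depend only on the squared chordal distance \<open>D\<close>.  The
  bumps that do not vanish at \<open>y\<close> have centres close to \<open>y\<close>, hence to each other.\<close>

lemma odd_sphere_map_imp_finitely_carried:
  assumes cont: "continuous_on (Sph n) q"
    and q: "\<And>x. x \<in> Sph n \<Longrightarrow> q x \<in> Sph m"
    and odd: "\<And>x. x \<in> Sph n \<Longrightarrow> q (antipode x) = antipode (q x)"
    and \<epsilon>: "0 < \<epsilon>"
  shows "\<exists>f. finitely_carried_odd n m \<epsilon> f"
proof -
  define \<delta> where "\<delta> = min \<epsilon> pi"
  \<comment> \<open>Squared chordal distance less than \<open>s\<close> from a common point forces squared distance less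
    than \<open>4 * s\<close>, and the latter is the squared chord length of an arc of length \<open>\<delta>\<close>.\<close>
  define s where "s = (1 - cos \<delta>) / 2"
  have \<delta>: "0 < \<delta>" "\<delta> \<le> pi" "\<delta> \<le> \<epsilon>"
    using \<epsilon> by (auto simp: \<delta>_def)
  have "cos \<delta> < cos 0"
    using \<delta> by (intro cos_monotone_0_pi) auto
  then have s: "0 < s"
    by (simp add: s_def)
  define D :: "(nat \<Rightarrow> real) \<Rightarrow> (nat \<Rightarrow> real) \<Rightarrow> real" where "D = (\<lambda>v y. \<Sum>i\<le>m. (v i - y i)\<^sup>2)"
  have D_anti: "D (antipode v) (antipode y) = D v y" for v y
    by (auto simp: D_def antipode_def power2_commute intro!: sum.cong)
  have contD: "continuous_on A (D v)" for v A
    unfolding D_def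
    by (intro continuous_intros continuous_on_subset[OF continuous_on_product_coordinates]) auto
  have "open {y. D v y < s}" for v
    by (intro open_Collect_less contD continuous_on_const)
  moreover have "Sph m \<subseteq> (\<Union>v\<in>Sph m. {y. D v y < s})"
    using s by (auto simp: D_def intro!: bexI)
  ultimately obtain N0 where N0: "N0 \<subseteq> Sph m" "finite N0" "Sph m \<subseteq> (\<Union>v\<in>N0. {y. D v y < s})"
    by (rule compactE_image[OF compact_Sph])
  define N where "N = N0 \<union> antipode ` N0"
  have N: "finite N" "N \<subseteq> Sph m"
    using N0 by (auto simp: N_def)
  have N_anti: "antipode v \<in> N \<longleftrightarrow> v \<in> N" for v
    unfolding N_def by (rule antipode_mem_symmetrize_iff)
  define \<phi> where "\<phi> = (\<lambda>v y. max 0 (s - D v y))"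
  define T where "T = (\<lambda>y. \<Sum>w\<in>N. \<phi> w y)"
  define f where "f = (\<lambda>x v. if v \<in> N then \<phi> v (q x) / T (q x) else 0)"
  have \<phi>0: "0 \<le> \<phi> v y" for v y
    by (simp add: \<phi>_def)
  have \<phi>_anti: "\<phi> (antipode v) (antipode y) = \<phi> v y" for v y
    by (simp add: \<phi>_def D_anti)
  have T_anti: "T (antipode y) = T y" for y
    unfolding T_def
    by (rule sum.reindex_bij_witness[of _ antipode antipode])
       (auto simp: N_anti \<phi>_anti, metis \<phi>_anti antipode_antipode)
  have T_pos: "0 < T y" if "y \<in> Sph m" for y
  proof -
    obtain v where "v \<in> N0" "D v y < s"
      using N0(3) \<open>y \<in> Sph m\<close> by auto
    then show ?thesis
      unfolding T_def using N(1) \<phi>0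
      by (intro sum_pos2[of N v]) (auto simp: N_def \<phi>_def)
  qed
  have "f (antipode x) v = f x (antipode v)" if x: "x \<in> Sph n" for x v
    using odd[OF x] \<phi>_anti[of "antipode v" "q x"] by (simp add: f_def N_anti T_anti)
  moreover have "continuous_on (Sph n) (\<lambda>x. f x v)" for v
  proof -
    have "continuous_on (Sph n) (\<lambda>x. \<phi> w (q x))" for w
      unfolding \<phi>_def
      by (intro continuous_intros continuous_on_compose2[OF contD[of UNIV] cont]) auto
    moreover from this have "continuous_on (Sph n) (\<lambda>x. T (q x))"
      unfolding T_def by (intro continuous_on_sum)
    moreover have "T (q x) \<noteq> 0" if "x \<in> Sph n" for x
      using T_pos[OF q[OF that]] by simp
    ultimately show ?thesis
      unfolding f_def by (cases "v \<in> N") (auto intro!: continuous_intros)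
  qed
  moreover have "\<exists>\<sigma>\<in>{\<sigma>. \<sigma> \<subseteq> N \<and> \<sigma> \<in> VRS m \<epsilon>}. f x \<in> closed_simplex \<sigma>" if x: "x \<in> Sph n" for x
  proof
    let ?\<sigma> = "{v \<in> N. \<phi> v (q x) \<noteq> 0}"
    have T: "0 < T (q x)"
      using T_pos q x by blast
    then have "?\<sigma> \<noteq> {}"
      unfolding T_def using sum.neutral[of N "\<lambda>w. \<phi> w (q x)"] by force
    moreover have "sphere_dist m v w \<le> \<epsilon>" if v: "v \<in> ?\<sigma>" and w: "w \<in> ?\<sigma>" for v w
    proof -
      have vw: "v \<in> Sph m" "w \<in> Sph m"
        using v w N by auto
      have "D v w \<le> (\<Sum>i\<le>m. 2 * (v i - q x i)\<^sup>2 + 2 * (w i - q x i)\<^sup>2)"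
        unfolding D_def
      proof (rule sum_mono)
        fix i
        have "0 \<le> ((v i - q x i) + (w i - q x i))\<^sup>2"
          by simp
        then show "(v i - w i)\<^sup>2 \<le> 2 * (v i - q x i)\<^sup>2 + 2 * (w i - q x i)\<^sup>2"
          by (simp add: power2_eq_square algebra_simps)
      qed
      also have "\<dots> = 2 * D v (q x) + 2 * D w (q x)"
        by (simp add: D_def sum.distrib sum_distrib_left)
      also have "\<dots> < 4 * s"
        using v w by (auto simp: \<phi>_def max_def split: if_splits)
      finally have "D v w < 4 * s" .
      moreover have "D v w = 2 - 2 * (\<Sum>i\<le>m. v i * w i)"
        using vw by (simp add: D_def power2_diff sum.distrib sum_subtractf Sph_iff
            sum_distrib_left mult.assoc)
      ultimately have "cos \<delta> \<le> (\<Sum>i\<le>m. v i * w i)"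
        by (simp add: s_def)
      then show ?thesis
        using sphere_dist_le_iff[OF vw, of \<delta>] \<delta> by simp
    qed
    ultimately show "?\<sigma> \<in> {\<sigma>. \<sigma> \<subseteq> N \<and> \<sigma> \<in> VRS m \<epsilon>}"
      using N by (auto simp: VR_complex_iff)
    have "(\<Sum>v\<in>?\<sigma>. f x v) = (\<Sum>v\<in>N. f x v)"
      using N by (intro sum.mono_neutral_left) (auto simp: f_def)
    also have "\<dots> = T (q x) / T (q x)"
      by (simp add: f_def T_def flip: sum_divide_distrib)
    finally show "f x \<in> closed_simplex ?\<sigma>"
      using T \<phi>0 by (auto simp: closed_simplex_def f_def)
  qed
  moreover have "finite {\<sigma>. \<sigma> \<subseteq> N \<and> \<sigma> \<in> VRS m \<epsilon>}"
    using N by (auto intro: finite_subset[of _ "Pow N"])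
  ultimately have "finitely_carried_odd n m \<epsilon> f"
    unfolding finitely_carried_odd_def
    by (intro conjI exI[of _ "{\<sigma>. \<sigma> \<subseteq> N \<and> \<sigma> \<in> VRS m \<epsilon>}"]) auto
  then show ?thesis
    by blast
qed

text \<open>The direction of the part of \<open>y\<close> in the first \<open>k + 1\<close> coordinates.  If that part is zero,
  so is the result, which then does not lie on the sphere.\<close>

definition unit_dir :: "nat \<Rightarrow> (nat \<Rightarrow> real) \<Rightarrow> nat \<Rightarrow> real" where
  "unit_dir k y = (\<lambda>i. if i \<le> k then y i / sqrt (\<Sum>j\<le>k. (y j)\<^sup>2) else 0)"

lemma unit_dir_in_Sph:
  assumes "(\<Sum>j\<le>k. (y j)\<^sup>2) \<noteq> 0"
  shows "unit_dir k y \<in> Sph k"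
proof -
  have "0 \<le> (\<Sum>j\<le>k. (y j)\<^sup>2)"
    by (simp add: sum_nonneg)
  then have "(\<Sum>i\<le>k. (unit_dir k y i)\<^sup>2) = (\<Sum>i\<le>k. (y i)\<^sup>2) / (\<Sum>j\<le>k. (y j)\<^sup>2)"
    by (simp add: unit_dir_def power_divide flip: sum_divide_distrib)
  moreover have "\<forall>i>k. unit_dir k y i = 0"
    by (simp add: unit_dir_def)
  ultimately show ?thesis
    using assms by (simp add: Sph_iff)
qed

lemma unit_dir_antipode: "unit_dir k (antipode y) = antipode (unit_dir k y)"
  by (simp add: unit_dir_def antipode_def fun_eq_iff)

lemma continuous_on_unit_dir: "continuous_on {y. (\<Sum>j\<le>k. (y j)\<^sup>2) \<noteq> 0} (unit_dir k)"
proof (rule continuous_on_coordinatewise_then_product)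
  have coord: "continuous_on A (\<lambda>y::nat \<Rightarrow> real. y j)" for A j
    by (rule continuous_on_subset[OF continuous_on_product_coordinates]) auto
  show "continuous_on {y. (\<Sum>j\<le>k. (y j)\<^sup>2) \<noteq> 0} (\<lambda>y. unit_dir k y i)" for i
    unfolding unit_dir_def
    by (cases "i \<le> k") (auto intro!: continuous_on_divide continuous_on_real_sqrt continuous_on_sum
        continuous_on_power coord)
qed

text \<open>The map \<open>q\<close> is the normalized barycentric combination of the vertices.  It is defined because
  at scale \<open>pi/2\<close> the vertices of a simplex have nonnegative inner products, so the
  combination has positive inner product with any vertex of positive weight.\<close>

lemma finitely_carried_odd_halfpi_imp_odd_sphere_map:
  assumes f: "finitely_carried_odd n m (pi/2) f"
  obtains q where "continuous_on (Sph n) q"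
    and "\<And>x. x \<in> Sph n \<Longrightarrow> q x \<in> Sph m"
    and "\<And>x. x \<in> Sph n \<Longrightarrow> q (antipode x) = antipode (q x)"
proof -
  obtain F where F: "finite F" "F \<subseteq> VRS m (pi/2)"
    and carried: "\<And>x. x \<in> Sph n \<Longrightarrow> \<exists>\<sigma>\<in>F. f x \<in> closed_simplex \<sigma>"
    and odd: "\<And>x v. x \<in> Sph n \<Longrightarrow> f (antipode x) v = f x (antipode v)"
    and cont: "\<And>v. continuous_on (Sph n) (\<lambda>x. f x v)"
    using f unfolding finitely_carried_odd_def by metis
  \<comment> \<open>A finite vertex set independent of \<open>x\<close> makes the combination continuous; it is symmetrized
    to make it odd.\<close>
  define V where "V = \<Union>F \<union> antipode ` \<Union>F"
  have V: "finite V" and FV: "\<And>\<sigma>. \<sigma> \<in> F \<Longrightarrow> \<sigma> \<subseteq> V"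
    using F by (auto simp: V_def VR_complex_iff subset_iff)
  have V_anti: "antipode v \<in> V \<longleftrightarrow> v \<in> V" for v
    unfolding V_def by (rule antipode_mem_symmetrize_iff)
  define p where "p = (\<lambda>x i. \<Sum>v\<in>V. f x v * v i)"
  have p_odd: "p (antipode x) = antipode (p x)" if "x \<in> Sph n" for x
  proof
    fix i
    have "(\<Sum>v\<in>V. f (antipode x) v * v i) = (\<Sum>v\<in>V. - (f x v * v i))"
      by (rule sum.reindex_bij_witness[of _ antipode antipode])
         (auto simp: V_anti odd[OF that], simp add: antipode_def)
    then show "p (antipode x) i = antipode (p x) i"
      by (simp add: p_def antipode_def sum_negf)
  qed
  have p_nz: "(\<Sum>i\<le>m. (p x i)\<^sup>2) \<noteq> 0" if x: "x \<in> Sph n" for x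
  proof
    assume zero: "(\<Sum>i\<le>m. (p x i)\<^sup>2) = 0"
    obtain \<sigma> where \<sigma>: "\<sigma> \<in> F" "f x \<in> closed_simplex \<sigma>"
      using carried x by blast
    have \<sigma>': "finite \<sigma>" "\<sigma> \<subseteq> Sph m" "\<And>v w. v \<in> \<sigma> \<Longrightarrow> w \<in> \<sigma> \<Longrightarrow> sphere_dist m v w \<le> pi/2"
      using subsetD[OF F(2) \<sigma>(1)] unfolding VR_complex_iff by blast+
    have t: "\<And>v. 0 \<le> f x v" "\<And>v. v \<notin> \<sigma> \<Longrightarrow> f x v = 0" "sum (f x) \<sigma> = 1"
      using \<sigma>(2) by (auto simp: closed_simplex_def)
    then obtain v0 where v0: "v0 \<in> \<sigma>" "f x v0 \<noteq> 0"
      by (metis sum.neutral zero_neq_one)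
    have inner: "0 \<le> (\<Sum>i\<le>m. v i * v0 i)" if "v \<in> \<sigma>" for v
      using sphere_dist_le_iff[of v m v0 "pi/2"] \<sigma>' v0(1) that by auto
    have p_eq: "p x i = (\<Sum>v\<in>\<sigma>. f x v * v i)" for i
      unfolding p_def using V FV[OF \<sigma>(1)] t(2) by (intro sum.mono_neutral_right) auto
    have "(\<Sum>i\<le>m. p x i * v0 i) = (\<Sum>v\<in>\<sigma>. f x v * (\<Sum>i\<le>m. v i * v0 i))"
      unfolding p_eq sum_distrib_left sum_distrib_right by (subst sum.swap) (simp add: mult.assoc)
    moreover have "0 < (\<Sum>v\<in>\<sigma>. f x v * (\<Sum>i\<le>m. v i * v0 i))"
    proof (rule sum_pos2[OF \<sigma>'(1) v0(1)])
      have "(\<Sum>i\<le>m. v0 i * v0 i) = 1"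
        using v0(1) \<sigma>'(2) by (auto simp: Sph_iff power2_eq_square)
      then show "0 < f x v0 * (\<Sum>i\<le>m. v0 i * v0 i)"
        using t(1)[of v0] v0(2) by simp
    qed (use t inner in auto)
    moreover have "p x i = 0" if "i \<le> m" for i
      using zero that by (simp add: sum_nonneg_eq_0_iff)
    ultimately show False
      by simp
  qed
  have "continuous_on (Sph n) p"
    unfolding p_def
    by (intro continuous_on_coordinatewise_then_product continuous_intros cont)
  then have "continuous_on (Sph n) (\<lambda>x. unit_dir m (p x))"
    using p_nz by (intro continuous_on_compose2[OF continuous_on_unit_dir]) auto
  then show thesis
    using unit_dir_in_Sph[OF p_nz] by (intro that[of "\<lambda>x. unit_dir m (p x)"]) (simp_all add: p_odd unit_dir_antipode)
qed

section \<open>Joins\<close>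

text \<open>The direction is discontinuous where its argument vanishes, but there the factor in front
  tends to zero while \<open>\<phi>\<close> stays bounded.\<close>

lemma continuous_on_radial_extension:
  fixes \<phi> :: "(nat \<Rightarrow> real) \<Rightarrow> real"
  assumes \<phi>: "continuous_on (Sph k) \<phi>" and bound: "\<And>y. y \<in> Sph k \<Longrightarrow> \<bar>\<phi> y\<bar> \<le> B"
  shows "continuous_on UNIV (\<lambda>y. (\<Sum>j\<le>k. (y j)\<^sup>2) * \<phi> (unit_dir k y))"
proof -
  define A :: "(nat \<Rightarrow> real) \<Rightarrow> real" where "A = (\<lambda>y. \<Sum>j\<le>k. (y j)\<^sup>2)"
  have contA: "continuous_on UNIV A"
    unfolding A_def by (intro continuous_intros continuous_on_product_coordinates)
  have "isCont (\<lambda>y. A y * \<phi> (unit_dir k y)) z" for z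
  proof (cases "A z = 0")
    case False
    have "open {y. A y \<noteq> 0}"
      by (intro open_Collect_neq contA continuous_on_const)
    moreover have "continuous_on {y. A y \<noteq> 0} (\<lambda>y. A y * \<phi> (unit_dir k y))"
      using unit_dir_in_Sph continuous_on_unit_dir
      by (intro continuous_on_mult continuous_on_subset[OF contA] continuous_on_compose2[OF \<phi>])
         (auto simp: A_def)
    ultimately show ?thesis
      using False continuous_on_eq_continuous_at by blast
  next
    case True
    have "(A \<longlongrightarrow> 0) (at z)"
      using contA True continuous_on_eq_continuous_at[of UNIV A] by (metis UNIV_I isCont_def open_UNIV)
    then have lim: "((\<lambda>y. \<bar>A y\<bar> * B) \<longlongrightarrow> 0) (at z)"
      by (intro tendsto_mult_left_zero tendsto_rabs_zero)
    have le: "norm (A y * \<phi> (unit_dir k y)) \<le> \<bar>A y\<bar> * B" for y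
    proof (cases "A y = 0")
      case False
      then show ?thesis
        using bound[OF unit_dir_in_Sph[of y k]] by (simp add: A_def abs_mult mult_left_mono)
    qed simp
    have "((\<lambda>y. A y * \<phi> (unit_dir k y)) \<longlongrightarrow> 0) (at z)"
      by (rule Lim_null_comparison[OF always_eventually lim]) (use le in blast)
    then show ?thesis
      using True by (simp add: isCont_def)
  qed
  then show ?thesis
    unfolding A_def by (simp add: continuous_on_eq_continuous_at)
qed

definition drop_coords :: "nat \<Rightarrow> (nat \<Rightarrow> real) \<Rightarrow> nat \<Rightarrow> real" where
  "drop_coords k x = (\<lambda>i. x (i + k))"

definition shift_coords :: "nat \<Rightarrow> (nat \<Rightarrow> real) \<Rightarrow> nat \<Rightarrow> real" where
  "shift_coords k x = (\<lambda>i. if i < k then 0 else x (i - k))"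

text \<open>The map of realizations induced by the injective vertex map \<open>shift_coords k\<close>, in a form in
  which each coordinate depends on at most one coordinate of \<open>t\<close>.\<close>

definition shift_weights :: "nat \<Rightarrow> ((nat \<Rightarrow> real) \<Rightarrow> real) \<Rightarrow> (nat \<Rightarrow> real) \<Rightarrow> real" where
  "shift_weights k t w = (if \<forall>i<k. w i = 0 then t (drop_coords k w) else 0)"

lemma drop_shift_coords [simp]: "drop_coords k (shift_coords k x) = x"
  by (simp add: drop_coords_def shift_coords_def)

lemma shift_drop_coords: "\<forall>i<k. w i = 0 \<Longrightarrow> shift_coords k (drop_coords k w) = w"
  by (auto simp: drop_coords_def shift_coords_def)

lemma shift_weights_closed_simplex:
  assumes t: "t \<in> closed_simplex \<tau>"
  shows "shift_weights k t \<in> closed_simplex (shift_coords k ` \<tau>)"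
proof -
  have "inj_on (shift_coords k) \<tau>"
    by (rule inj_on_inverseI[where g = "drop_coords k"]) simp
  then have "(\<Sum>w\<in>shift_coords k ` \<tau>. shift_weights k t w)
      = (\<Sum>v\<in>\<tau>. shift_weights k t (shift_coords k v))"
    by (simp add: sum.reindex)
  also have "\<dots> = sum t \<tau>"
    by (intro sum.cong) (auto simp: shift_weights_def, auto simp: shift_coords_def)
  finally have "(\<Sum>w\<in>shift_coords k ` \<tau>. shift_weights k t w) = 1"
    using t by (simp add: closed_simplex_def)
  moreover have "shift_weights k t w = 0" if "w \<notin> shift_coords k ` \<tau>" for w
  proof (cases "\<forall>i<k. w i = 0")
    case True
    then have "drop_coords k w \<notin> \<tau>"
      using that shift_drop_coords by (metis imageI)
    then show ?thesis
      using t by (simp add: shift_weights_def closed_simplex_def)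
  next
    case False
    then show ?thesis
      unfolding shift_weights_def by (rule if_not_P)
  qed
  moreover have "0 \<le> shift_weights k t w" for w
    using t by (simp add: shift_weights_def closed_simplex_def)
  ultimately show ?thesis
    by (simp add: closed_simplex_def)
qed

lemma closed_simplex_convex_Un:
  assumes "t \<in> closed_simplex \<sigma>" "u \<in> closed_simplex \<tau>" "finite \<sigma>" "finite \<tau>"
    and "0 \<le> a" "0 \<le> b" "a + b = 1"
  shows "(\<lambda>v. a * t v + b * u v) \<in> closed_simplex (\<sigma> \<union> \<tau>)"
proof -
  have "t v = 0" if "v \<notin> \<sigma>" for v
    using assms(1) that by (simp add: closed_simplex_def)
  moreover have "u v = 0" if "v \<notin> \<tau>" for v
    using assms(2) that by (simp add: closed_simplex_def)
  ultimately have "sum t (\<sigma> \<union> \<tau>) = sum t \<sigma>" "sum u (\<sigma> \<union> \<tau>) = sum u \<tau>"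
    using assms(3,4) by (auto intro!: sum.mono_neutral_right)
  then show ?thesis
    using assms by (auto simp: closed_simplex_def sum.distrib simp flip: sum_distrib_left)
qed

lemma sum_atMost_split:
  fixes g :: "nat \<Rightarrow> 'a::comm_monoid_add"
  shows "(\<Sum>i\<le>Suc (n + n'). g i) = (\<Sum>i\<le>n. g i) + (\<Sum>i\<le>n'. g (i + Suc n))"
  by (induction n') (simp_all add: add_ac)

text \<open>The two vertex sets lie in orthogonal subspaces, so points of different sets are at distance
  exactly \<open>pi/2\<close>.\<close>

lemma join_simplex_in_VRS:
  assumes \<sigma>: "\<sigma> \<in> VRS m r" and \<tau>: "\<tau> \<in> VRS m' r" and r: "pi/2 \<le> r"
  shows "\<sigma> \<union> shift_coords (Suc m) ` \<tau> \<in> VRS (Suc (m + m')) r"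
proof -
  let ?M = "Suc (m + m')" and ?sh = "shift_coords (Suc m)"
  have sh: "?sh v \<in> Sph ?M" if "v \<in> Sph m'" for v
  proof -
    have "(\<Sum>i\<le>?M. (?sh v i)\<^sup>2) = (\<Sum>i\<le>m'. (v i)\<^sup>2)"
      unfolding sum_atMost_split by (simp add: shift_coords_def)
    then show ?thesis
      using that by (auto simp: Sph_iff shift_coords_def)
  qed
  have same: "sphere_dist ?M (?sh v) (?sh w) = sphere_dist m' v w" for v w
    unfolding sphere_dist_def sum_atMost_split by (simp add: shift_coords_def)
  have cross: "sphere_dist ?M v (?sh w) = pi/2" "sphere_dist ?M (?sh w) v = pi/2"
    if "v \<in> Sph m" for v w
  proof -
    have "(\<Sum>i\<le>?M. v i * ?sh w i) = 0"
      unfolding sum_atMost_split using that by (simp add: shift_coords_def Sph_iff)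
    then show "sphere_dist ?M v (?sh w) = pi/2" "sphere_dist ?M (?sh w) v = pi/2"
      by (simp_all add: sphere_dist_def mult.commute)
  qed
  have "sphere_dist ?M v w \<le> r" if "v \<in> \<sigma> \<union> ?sh ` \<tau>" "w \<in> \<sigma> \<union> ?sh ` \<tau>" for v w
    using that \<sigma> \<tau> r sphere_dist_mono_dim[of m ?M v w]
    by (auto simp: VR_complex_iff same cross subset_iff)
  then show ?thesis
    using \<sigma> \<tau> Sph_mono[of m ?M] sh by (auto simp: VR_complex_iff)
qed

lemma closed_simplex_le_1:
  assumes "t \<in> closed_simplex \<sigma>" "finite \<sigma>"
  shows "\<bar>t v\<bar> \<le> 1"
proof (cases "v \<in> \<sigma>")
  case True
  then have "t v \<le> sum t \<sigma>"
    using assms by (intro member_le_sum) (auto simp: closed_simplex_def)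
  then show ?thesis
    using assms by (simp add: closed_simplex_def)
qed (use assms in \<open>simp add: closed_simplex_def\<close>)

text \<open>Write \<open>(x, y)\<close> for a point of the large sphere split into its first \<open>n + 1\<close> and its
  remaining coordinates.  The join \<open>h\<close> sends it to \<open>f (x / |x|)\<close> with weight \<open>|x|^2\<close> plus
  \<open>g (y / |y|)\<close> with weight \<open>|y|^2\<close>.  The weights add up to one, they are invariant under the
  antipode, and they vanish exactly where the corresponding direction is undefined.\<close>

lemma finitely_carried_odd_join:
  assumes f: "finitely_carried_odd n m r f" and g: "finitely_carried_odd n' m' r g"
    and r: "pi/2 \<le> r"
  shows "\<exists>h. finitely_carried_odd (Suc (n + n')) (Suc (m + m')) r h"
proof -
  obtain F where F: "finite F" "F \<subseteq> VRS m r"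
    and f_carried: "\<And>x. x \<in> Sph n \<Longrightarrow> \<exists>\<sigma>\<in>F. f x \<in> closed_simplex \<sigma>"
    and f_odd: "\<And>x v. x \<in> Sph n \<Longrightarrow> f (antipode x) v = f x (antipode v)"
    and f_cont: "\<And>v. continuous_on (Sph n) (\<lambda>x. f x v)"
    using f unfolding finitely_carried_odd_def by metis
  obtain G where G: "finite G" "G \<subseteq> VRS m' r"
    and g_carried: "\<And>x. x \<in> Sph n' \<Longrightarrow> \<exists>\<tau>\<in>G. g x \<in> closed_simplex \<tau>"
    and g_odd: "\<And>x v. x \<in> Sph n' \<Longrightarrow> g (antipode x) v = g x (antipode v)"
    and g_cont: "\<And>v. continuous_on (Sph n') (\<lambda>x. g x v)"
    using g unfolding finitely_carried_odd_def by metis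
  have finF: "finite \<sigma>" if "\<sigma> \<in> F" for \<sigma>
    using that F(2) by (auto simp: VR_complex_iff subset_iff)
  have finG: "finite \<tau>" if "\<tau> \<in> G" for \<tau>
    using that G(2) by (auto simp: VR_complex_iff subset_iff)
  define A :: "(nat \<Rightarrow> real) \<Rightarrow> real" where "A = (\<lambda>x. \<Sum>i\<le>n. (x i)\<^sup>2)"
  define B :: "(nat \<Rightarrow> real) \<Rightarrow> real" where "B = (\<lambda>y. \<Sum>i\<le>n'. (y i)\<^sup>2)"
  let ?drop = "drop_coords (Suc n)"
  define h where "h = (\<lambda>x w. A x * f (unit_dir n x) w
    + B (?drop x) * shift_weights (Suc m) (g (unit_dir n' (?drop x))) w)"
  have A_anti: "A (antipode x) = A x" and B_anti: "B (antipode x) = B x" for x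
    by (simp_all add: A_def B_def antipode_def)
  have drop_anti: "drop_coords k (antipode x) = antipode (drop_coords k x)" for k x
    by (simp add: drop_coords_def antipode_def)
  have f_unit: "A x * f (unit_dir n (antipode x)) w = A x * f (unit_dir n x) (antipode w)" for x w
    using f_odd[OF unit_dir_in_Sph[of x n]] by (cases "A x = 0") (auto simp: A_def unit_dir_antipode)
  have g_unit: "B y * g (unit_dir n' (antipode y)) w = B y * g (unit_dir n' y) (antipode w)" for y w
    using g_odd[OF unit_dir_in_Sph[of y n']] by (cases "B y = 0") (auto simp: B_def unit_dir_antipode)
  have sw: "c * shift_weights k t w = (if \<forall>i<k. w i = 0 then c * t (drop_coords k w) else 0)"
    for c k t w
    by (simp only: shift_weights_def if_distrib[of "\<lambda>z. c * z"] mult_zero_right)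
  have "h (antipode x) w = h x (antipode w)" for x w
  proof -
    have "(\<forall>i<k. antipode w i = 0) \<longleftrightarrow> (\<forall>i<k. w i = 0)" for k
      by (simp add: antipode_def)
    then show ?thesis
      unfolding h_def sw by (simp add: A_anti B_anti drop_anti f_unit g_unit) blast
  qed
  moreover have "continuous_on (Sph (Suc (n + n'))) (\<lambda>x. h x w)" for w
  proof -
    have f_part: "continuous_on UNIV (\<lambda>x. A x * f (unit_dir n x) w)" for w
      unfolding A_def
    proof (rule continuous_on_radial_extension[OF f_cont])
      fix y assume "y \<in> Sph n"
      then obtain \<sigma> where "\<sigma> \<in> F" "f y \<in> closed_simplex \<sigma>"
        using f_carried by blast
      then show "\<bar>f y w\<bar> \<le> 1"
        by (intro closed_simplex_le_1[of _ \<sigma>] finF)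
    qed
    have g_part: "continuous_on UNIV (\<lambda>y. B y * g (unit_dir n' y) w)" for w
      unfolding B_def
    proof (rule continuous_on_radial_extension[OF g_cont])
      fix y assume "y \<in> Sph n'"
      then obtain \<tau> where "\<tau> \<in> G" "g y \<in> closed_simplex \<tau>"
        using g_carried by blast
      then show "\<bar>g y w\<bar> \<le> 1"
        by (intro closed_simplex_le_1[of _ \<tau>] finG)
    qed
    have "continuous_on UNIV ?drop"
      unfolding drop_coords_def
      by (intro continuous_on_coordinatewise_then_product continuous_on_product_coordinates)
    then have "continuous_on UNIV (\<lambda>x. B (?drop x) * g (unit_dir n' (?drop x)) w)" for w
      by (rule continuous_on_compose2[OF g_part]) simp
    then have "continuous_on UNIV (\<lambda>x. if P then B (?drop x) * g (unit_dir n' (?drop x)) w else 0)"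
      for P w
      by (cases P) simp_all
    then have "continuous_on UNIV (\<lambda>x. h x w)"
      unfolding h_def sw by (intro continuous_on_add f_part)
    then show ?thesis
      by (rule continuous_on_subset) simp
  qed
  moreover have "\<exists>\<rho>\<in>(\<lambda>(\<sigma>, \<tau>). \<sigma> \<union> shift_coords (Suc m) ` \<tau>) ` (F \<times> G). h x \<in> closed_simplex \<rho>"
    if x: "x \<in> Sph (Suc (n + n'))" for x
  proof -
    have AB: "A x + B (?drop x) = 1"
      using x unfolding Sph_iff sum_atMost_split by (simp add: A_def B_def drop_coords_def)
    \<comment> \<open>Where a weight is zero, its term may be replaced by any point of the complex; the value of
      \<open>f\<close> or \<open>g\<close> at a base point of the sphere is used.\<close>
    obtain \<sigma> t where \<sigma>: "\<sigma> \<in> F" "t \<in> closed_simplex \<sigma>" "\<And>w. A x * f (unit_dir n x) w = A x * t w"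
    proof (cases "A x = 0")
      case True
      then show thesis
        using f_carried[OF in_topspace_nsphere] that by auto
    next
      case False
      then show thesis
        using f_carried[OF unit_dir_in_Sph[of x n]] that by (auto simp: A_def)
    qed
    obtain \<tau> u where \<tau>: "\<tau> \<in> G" "u \<in> closed_simplex \<tau>"
      "\<And>w. B (?drop x) * g (unit_dir n' (?drop x)) w = B (?drop x) * u w"
    proof (cases "B (?drop x) = 0")
      case True
      then show thesis
        using g_carried[OF in_topspace_nsphere] that by auto
    next
      case False
      then show thesis
        using g_carried[OF unit_dir_in_Sph[of "?drop x" n']] that by (auto simp: B_def)
    qed
    have "h x = (\<lambda>w. A x * t w + B (?drop x) * shift_weights (Suc m) u w)"
      unfolding h_def sw \<sigma>(3) \<tau>(3) ..
    moreover have "(\<lambda>w. A x * t w + B (?drop x) * shift_weights (Suc m) u w)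
        \<in> closed_simplex (\<sigma> \<union> shift_coords (Suc m) ` \<tau>)"
      using \<sigma> \<tau> finF finG AB
      by (intro closed_simplex_convex_Un shift_weights_closed_simplex)
         (auto simp: A_def B_def sum_nonneg)
    ultimately show ?thesis
      using \<sigma>(1) \<tau>(1) by auto
  qed
  moreover have "(\<lambda>(\<sigma>, \<tau>). \<sigma> \<union> shift_coords (Suc m) ` \<tau>) ` (F \<times> G) \<subseteq> VRS (Suc (m + m')) r"
    by (auto intro!: join_simplex_in_VRS[OF _ _ r] subsetD[OF F(2)] subsetD[OF G(2)])
  ultimately have "finitely_carried_odd (Suc (n + n')) (Suc (m + m')) r h"
    unfolding finitely_carried_odd_def using F(1) G(1)
    by (intro conjI exI[of _ "(\<lambda>(\<sigma>, \<tau>). \<sigma> \<union> shift_coords (Suc m) ` \<tau>) ` (F \<times> G)"]) auto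
  then show ?thesis
    by blast
qed

section \<open>The infimum of scales and the sets of pairs\<close>

lemma finitely_carried_odd_diagonal:
  assumes "0 < r"
  shows "\<exists>f. finitely_carried_odd m m r f"
  using odd_sphere_map_imp_finitely_carried[of m "\<lambda>x. x" m r] assms by simp

text \<open>For \<open>n > 0\<close>, a supremum that is at least \<open>n\<close> has a member that is at least \<open>n\<close>, and the map
  can be restricted to the smaller sphere.  For \<open>n = 0\<close> the bound gives no map, as the supremum
  of the empty set is zero; the slack \<open>r < r'\<close> provides one from the diagonal case.\<close>

lemma coind_ge_imp_finitely_carried:
  assumes n: "enat n \<le> coind (VR_sphere m r) (realization_map antipode)"
    and r: "0 \<le> r" "r < r'"
  shows "\<exists>f. finitely_carried_odd n m r' f"
proof (cases n)
  case 0
  then show ?thesis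
    using finitely_carried_odd_diagonal[of r' m] finitely_carried_odd_mono[of m m r' _ 0 m r'] r
    by auto
next
  case (Suc k)
  have "\<exists>l f. n \<le> l \<and> finitely_carried_odd l m r f"
  proof (rule ccontr)
    assume "\<not> ?thesis"
    then have "l \<le> k" if "finitely_carried_odd l m r f" for l f
      using that Suc by (metis not_less_eq_eq)
    then have "coind (VR_sphere m r) (realization_map antipode) \<le> enat k"
      unfolding coind_def odd_map_into_VR_sphere_iff by (intro Sup_least) auto
    then show False
      using n Suc by (metis enat_ord_simps(1) not_less_eq_eq order_refl order_trans)
  qed
  then show ?thesis
    using finitely_carried_odd_mono r by (meson less_imp_le order_refl)
qed

lemma finitely_carried_imp_coind_ge:
  "finitely_carried_odd n m r f \<Longrightarrow> enat n \<le> coind (VR_sphere m r) (realization_map antipode)"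
  unfolding coind_def odd_map_into_VR_sphere_iff by (intro Sup_upper) blast

text \<open>The infimum need not be attained, so maps are asserted only at scales strictly
  above \<open>r\<close>.\<close>

lemma c_VR_le_iff:
  assumes r: "0 \<le> r"
  shows "c_VR m n \<le> r \<longleftrightarrow> (\<forall>r'>r. \<exists>f. finitely_carried_odd n m r' f)"
proof
  let ?R = "{r. 0 \<le> r \<and> enat n \<le> coind (VR_sphere m r) (realization_map antipode)}"
  assume c: "c_VR m n \<le> r"
  obtain f where "finitely_carried_odd n m pi f"
    using finitely_carried_odd_pi by blast
  then have "pi \<in> ?R"
    using finitely_carried_imp_coind_ge by auto
  show "\<forall>r'>r. \<exists>f. finitely_carried_odd n m r' f"
  proof (intro allI impI)
    fix r' assume "r < r'"
    then obtain s where "s \<in> ?R" "s < r'"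
      using cInf_lessD[of ?R r'] c \<open>pi \<in> ?R\<close> unfolding c_VR_def by force
    then show "\<exists>f. finitely_carried_odd n m r' f"
      using coind_ge_imp_finitely_carried by blast
  qed
next
  let ?R = "{r. 0 \<le> r \<and> enat n \<le> coind (VR_sphere m r) (realization_map antipode)}"
  assume maps: "\<forall>r'>r. \<exists>f. finitely_carried_odd n m r' f"
  show "c_VR m n \<le> r"
  proof (rule field_le_epsilon)
    fix e :: real assume "0 < e"
    then obtain f where "finitely_carried_odd n m (r + e) f"
      using maps by (meson less_add_same_cancel1)
    then have "r + e \<in> ?R"
      using \<open>0 < e\<close> r finitely_carried_imp_coind_ge by auto
    then show "c_VR m n \<le> r + e"
      unfolding c_VR_def by (intro cInf_lower) (auto intro!: bdd_belowI)
  qed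
qed

lemma Gam_Suc_iff:
  assumes "0 \<le> r"
  shows "(Suc m, Suc n) \<in> Gam r \<longleftrightarrow> m \<le> n \<and> (\<forall>r'>r. \<exists>f. finitely_carried_odd n m r' f)"
  using c_VR_le_iff[OF assms] by (simp add: Gam_def)

lemma Gam_cases:
  assumes "(k, l) \<in> Gam r"
  obtains m n where "k = Suc m" "l = Suc n"
  using assms that[of "k - 1" "l - 1"] by (auto simp: Gam_def)

text \<open>At scales \<open>r' \<ge> pi/2\<close> the join is directly available.  If \<open>r < pi/2\<close>, it is formed at
  \<open>pi/2\<close> and pushed down to any positive scale through a map of spheres.\<close>

lemma Gam_add:
  assumes r: "0 \<le> r" and kl: "(k, l) \<in> Gam r" and kl': "(k', l') \<in> Gam r"
  shows "(k + k', l + l') \<in> Gam r"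
proof -
  obtain m n where mn: "k = Suc m" "l = Suc n"
    using kl by (rule Gam_cases)
  obtain m' n' where mn': "k' = Suc m'" "l' = Suc n'"
    using kl' by (rule Gam_cases)
  have le: "m \<le> n" "m' \<le> n'"
    and maps: "\<And>r'. r < r' \<Longrightarrow> \<exists>f. finitely_carried_odd n m r' f"
      "\<And>r'. r < r' \<Longrightarrow> \<exists>f. finitely_carried_odd n' m' r' f"
    using kl kl' unfolding mn mn' Gam_Suc_iff[OF r] by blast+
  have join: "\<exists>h. finitely_carried_odd (Suc (n + n')) (Suc (m + m')) r' h"
    if "r < r'" "pi/2 \<le> r'" for r'
    using maps[OF that(1)] finitely_carried_odd_join[OF _ _ that(2)] by blast
  have "\<exists>h. finitely_carried_odd (Suc (n + n')) (Suc (m + m')) r' h" if r': "r < r'" for r'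
  proof (cases "r < pi/2")
    case True
    then obtain h where "finitely_carried_odd (Suc (n + n')) (Suc (m + m')) (pi/2) h"
      using join[of "pi/2"] by auto
    then obtain q where "continuous_on (Sph (Suc (n + n'))) q"
      "\<And>x. x \<in> Sph (Suc (n + n')) \<Longrightarrow> q x \<in> Sph (Suc (m + m'))"
      "\<And>x. x \<in> Sph (Suc (n + n')) \<Longrightarrow> q (antipode x) = antipode (q x)"
      using finitely_carried_odd_halfpi_imp_odd_sphere_map by blast
    then show ?thesis
      using r r' by (intro odd_sphere_map_imp_finitely_carried[of _ q]) auto
  next
    case False
    then show ?thesis
      using join r' by simp
  qed
  then have "(Suc (Suc (m + m')), Suc (Suc (n + n'))) \<in> Gam r"
    using le Gam_Suc_iff[OF r] by simp
  then show ?thesis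
    by (simp add: mn mn')
qed

lemma Gam_mono:
  assumes r: "0 \<le> r" and kl: "(k, l) \<in> Gam r" and le: "k \<le> k'" "l' \<le> l" "k' \<le> l'"
  shows "(k', l') \<in> Gam r"
proof -
  obtain m n where mn: "k = Suc m" "l = Suc n"
    using kl by (rule Gam_cases)
  obtain m' n' where mn': "k' = Suc m'" "l' = Suc n'"
    using le mn by (metis Suc_le_D)
  show ?thesis
    using kl le finitely_carried_odd_mono[of n m _ _ n' m'] unfolding mn mn' Gam_Suc_iff[OF r]
    by (metis Suc_le_mono order_refl)
qed

lemma one_one_in_Gam: "0 \<le> r \<Longrightarrow> (1, 1) \<in> Gam r"
  using Gam_Suc_iff[of r 0 0] finitely_carried_odd_diagonal by auto

theorem proposition6p1:
  fixes r :: real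
  assumes "0 \<le> r" and "r \<le> pi"
  shows "Gam r + Gam r \<subseteq> Gam r \<and>
    (\<forall>k l. (k, l) \<in> Gam r \<longrightarrow>
       (\<forall>d. (k + d, l + d) \<in> Gam r) \<and>
       (\<forall>k' l'. k \<le> k' \<and> l' \<le> l \<and> k' \<le> l' \<longrightarrow> (k', l') \<in> Gam r))"
proof (intro conjI allI impI)
  show "Gam r + Gam r \<subseteq> Gam r"
  proof
    fix z assume "z \<in> Gam r + Gam r"
    then obtain a b where "a \<in> Gam r" "b \<in> Gam r" "z = a + b"
      by (rule set_plus_elim)
    then show "z \<in> Gam r"
      using Gam_add[OF assms(1)] by (cases a; cases b) simp
  qed
next
  fix k l d assume "(k, l) \<in> Gam r"
  then show "(k + d, l + d) \<in> Gam r"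
  proof (induction d)
    case (Suc d)
    then show ?case
      using Gam_add[OF assms(1) _ one_one_in_Gam[OF assms(1)], of "k + d" "l + d"] by simp
  qed simp
next
  fix k l k' l' assume "(k, l) \<in> Gam r" "k \<le> k' \<and> l' \<le> l \<and> k' \<le> l'"
  then show "(k', l') \<in> Gam r"
    using Gam_mono[OF assms(1)] by blast
qed

end
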